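(* Let $k<n$ be positive integers. If $n$ is even then $\textsc{bm}(k,n,n)\le\min\left(k,\left\lfloor\frac{3n}{4}\right\rfloor\right)$; if $n$ is odd then $\textsc{bm}(k,n,n)\le\min\left(k,\left\lfloor\frac{3n+1}{4}\right\rfloor\right)$. That is, in each case there is a $(k,n,n)$-fractionally balanced tripartite hypergraph with no matching of size larger than the stated bound.
   Context: A hypergraph is identified with its finite edge set; a matching is a set of pairwise disjoint edges. A hypergraph $H$ is $k$-partite with sides $V_1,\ldots,V_k$ (a fixed partition of its vertex set) if $|e\cap V_t|=1$ for every edge $e$ and every $t$. For $f:H\to\mathbb{R}_{\ge0}$, $\deg_f(v)=\sum_{e\ni v}f(e)$; $f$ is balanced if $\deg_f$ is constant on each side. $H$ is $(b_1,\ldots,b_k)$-fractionally balanced if it is $k$-partite with sides of sizes $b_1,\ldots,b_k$ and has a nonzero balanced $f:H\to\mathbb{R}_{\ge0}$. $\textsc{bm}(b_1,\ldots,b_k)$ is the largest $m$ such that every $(b_1,\ldots,b_k)$-fractionally balanced $k$-partite hypergraph has a matching of size $m$. *)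

theory Defs
  imports Complex_Main
begin

definition is_matching :: "'a set set \<Rightarrow> 'a set set \<Rightarrow> bool" where
  "is_matching H M \<longleftrightarrow> M \<subseteq> H \<and> (\<forall>e\<in>M. \<forall>e'\<in>M. e \<noteq> e' \<longrightarrow> e \<inter> e' = {})"

text \<open>The list \<open>V\<close> holds the sides, so the number of sides is \<open>length V\<close> and the vertex set
  is the union of \<open>set V\<close>.\<close>

definition partite :: "'a set list \<Rightarrow> 'a set set \<Rightarrow> bool" where
  "partite V H \<longleftrightarrow>
     finite H \<and>
     (\<forall>t<length V. finite (V ! t)) \<and>
     (\<forall>s<length V. \<forall>t<length V. s \<noteq> t \<longrightarrow> V ! s \<inter> V ! t = {}) \<and>
     (\<forall>e\<in>H. e \<subseteq> \<Union> (set V)) \<and>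
     (\<forall>e\<in>H. \<forall>t<length V. card (e \<inter> V ! t) = 1)"

definition wdeg :: "'a set set \<Rightarrow> ('a set \<Rightarrow> real) \<Rightarrow> 'a \<Rightarrow> real" where
  "wdeg H f v = (\<Sum>e | e \<in> H \<and> v \<in> e. f e)"

definition balanced :: "'a set list \<Rightarrow> 'a set set \<Rightarrow> ('a set \<Rightarrow> real) \<Rightarrow> bool" where
  "balanced V H f \<longleftrightarrow> (\<forall>t<length V. \<exists>c. \<forall>v\<in>V ! t. wdeg H f v = c)"

definition fractionally_balanced :: "nat list \<Rightarrow> 'a set list \<Rightarrow> 'a set set \<Rightarrow> bool" where
  "fractionally_balanced b V H \<longleftrightarrow>
     partite V H \<and> map card V = b \<and>
     (\<exists>f. (\<forall>e\<in>H. 0 \<le> f e) \<and> (\<exists>e\<in>H. f e \<noteq> 0) \<and> balanced V H f)"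

text \<open>Every finite hypergraph is isomorphic to one with vertices in \<^typ>\<open>nat\<close>, so it suffices
  to quantify over those. If \<open>b\<close> is a nonempty list of positive numbers, the maximum exists:
  the complete partite hypergraph is fractionally balanced and bounds the admissible \<open>m\<close>.\<close>

definition bm :: "nat list \<Rightarrow> nat" where
  "bm b = (GREATEST m. \<forall>(V :: nat set list) H. fractionally_balanced b V H \<longrightarrow>
                         (\<exists>M. is_matching H M \<and> card M = m))"

end

theory Submission
  imports Defs
begin

text \<open>
  Put \<open>p = \<lfloor>k / 2\<rfloor>\<close> and cut \<open>2 p\<close> vertices of each side into \<open>p\<close> pairs. On the \<open>i\<close>-th pairs of
  the three sides place the four edges of even parity (the truncated Fano plane), any two of
  which meet, with weight \<open>k / 2\<close> each. The \<open>n - 2 p\<close> spare vertices of the second side and those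
  of the third side have their degree filled up by uniform weights: \<open>n - k\<close> in total from every
  paired vertex of the first side, \<open>n\<close> from an unpaired one. All degrees are then \<open>n\<close> on the first
  side and \<open>k\<close> on the other two. A matching takes at most one edge from each of the \<open>p\<close> planes and at
  most \<open>n - 2 p\<close> edges through spare vertices, hence at most \<open>n - p\<close> edges, and \<open>n - p\<close> is at most
  \<open>3 n / 4\<close> whenever \<open>k\<close> exceeds this value.
\<close>

section \<open>Tripartite hypergraphs encoded by weights on index triples\<close>

definition triple_edge :: "nat \<Rightarrow> nat \<Rightarrow> nat \<times> nat \<times> nat \<Rightarrow> nat set" where
  "triple_edge k n = (\<lambda>(a, b, c). {a, k + b, k + n + c})"

definition tri_sides :: "nat \<Rightarrow> nat \<Rightarrow> nat set list" where
  "tri_sides k n = [{..<k}, {k..<k + n}, {k + n..<k + n + n}]"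

text \<open>Triples of weight zero are left out, so every edge of a matching has nonzero weight;
  this is what restricts matchings later.\<close>

definition support3 :: "nat \<Rightarrow> nat \<Rightarrow> (nat \<Rightarrow> nat \<Rightarrow> nat \<Rightarrow> real) \<Rightarrow> (nat \<times> nat \<times> nat) set" where
  "support3 k n G = {(a, b, c). a < k \<and> b < n \<and> c < n \<and> G a b c \<noteq> 0}"

lemma finite_support3: "finite (support3 k n G)"
  by (rule finite_subset[of _ "{..<k} \<times> {..<n} \<times> {..<n}"]) (auto simp: support3_def)

lemma mem_triple_edge:
  assumes "a < k" "b < n" "c < n"
  shows "x < k \<Longrightarrow> x \<in> triple_edge k n (a, b, c) \<longleftrightarrow> a = x"
    and "y < n \<Longrightarrow> k + y \<in> triple_edge k n (a, b, c) \<longleftrightarrow> b = y"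
    and "k + n + z \<in> triple_edge k n (a, b, c) \<longleftrightarrow> c = z"
  using assms by (auto simp: triple_edge_def)

lemma inj_on_triple_edge: "inj_on (triple_edge k n) (support3 k n G)"
proof (rule inj_onI)
  fix x y
  assume *: "x \<in> support3 k n G" "y \<in> support3 k n G"
    and e: "triple_edge k n x = triple_edge k n y"
  obtain a b c where x: "x = (a, b, c)" by (cases x) auto
  obtain a' b' c' where y: "y = (a', b', c')" by (cases y) auto
  have "a < k" "b < n" "c < n" "a' < k" "b' < n" "c' < n"
    using * by (auto simp: support3_def x y)
  thus "x = y"
    using mem_triple_edge[of a k b n c] mem_triple_edge[of a' k b' n c'] e unfolding x y by metis
qed

lemma partite_triple_edges: "partite (tri_sides k n) (triple_edge k n ` support3 k n G)"
proof -
  have "card (triple_edge k n x \<inter> tri_sides k n ! t) = 1"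
    if x: "x \<in> support3 k n G" and t: "t < 3" for x t
  proof -
    obtain a b c where [simp]: "x = (a, b, c)" by (cases x) auto
    have "a < k" "b < n" "c < n" using x by (auto simp: support3_def)
    hence "triple_edge k n x \<inter> {..<k} = {a}" "triple_edge k n x \<inter> {k..<k + n} = {k + b}"
      "triple_edge k n x \<inter> {k + n..<k + n + n} = {k + n + c}"
      by (auto simp: triple_edge_def)
    moreover have "t = 0 \<or> t = 1 \<or> t = 2" using t by auto
    ultimately show ?thesis by (auto simp: tri_sides_def)
  qed
  moreover have "finite (tri_sides k n ! t)" if "t < 3" for t
  proof -
    have "t = 0 \<or> t = 1 \<or> t = 2" using that by auto
    thus ?thesis by (auto simp: tri_sides_def)
  qed
  moreover have "tri_sides k n ! s \<inter> tri_sides k n ! t = {}" if "s < 3" "t < 3" "s \<noteq> t" for s t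
  proof -
    have "s = 0 \<or> s = 1 \<or> s = 2" "t = 0 \<or> t = 1 \<or> t = 2" using that by auto
    thus ?thesis using that by (elim disjE) (auto simp: tri_sides_def)
  qed
  moreover have "triple_edge k n x \<subseteq> \<Union> (set (tri_sides k n))" if "x \<in> support3 k n G" for x
    using that by (auto simp: support3_def triple_edge_def tri_sides_def)
  moreover have "length (tri_sides k n) = 3" by (simp add: tri_sides_def)
  ultimately show ?thesis
    by (auto simp: partite_def finite_support3)
qed

text \<open>Edges correspond one-to-one to support triples, so the weight can be pulled back along
  \<open>inv_into\<close>. Triples off the support contribute zero, which allows the degrees to be
  summed over whole boxes.\<close>

lemma wdeg_triple_edges:
  fixes k n G
  defines "T \<equiv> support3 k n G"
  defines "f \<equiv> (\<lambda>(a, b, c). G a b c) \<circ> inv_into T (triple_edge k n)"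
  shows "x < k \<Longrightarrow> wdeg (triple_edge k n ` T) f x = (\<Sum>(b, c)\<in>{..<n} \<times> {..<n}. G x b c)"
    and "y < n \<Longrightarrow> wdeg (triple_edge k n ` T) f (k + y) = (\<Sum>(a, c)\<in>{..<k} \<times> {..<n}. G a y c)"
    and "z < n \<Longrightarrow> wdeg (triple_edge k n ` T) f (k + n + z) = (\<Sum>(a, b)\<in>{..<k} \<times> {..<n}. G a b z)"
proof -
  have deg: "wdeg (triple_edge k n ` T) f v
      = (\<Sum>(a, b, c)\<in>{t \<in> T. v \<in> triple_edge k n t}. G a b c)" for v
  proof -
    have *: "{e. e \<in> triple_edge k n ` T \<and> v \<in> e}
        = triple_edge k n ` {t \<in> T. v \<in> triple_edge k n t}" by auto
    have inj: "inj_on (triple_edge k n) T" unfolding T_def by (rule inj_on_triple_edge)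
    show ?thesis
      unfolding wdeg_def *
      by (subst sum.reindex)
        (auto intro!: inj_on_subset[OF inj] sum.cong simp: f_def inv_into_f_f[OF inj])
  qed
  show "wdeg (triple_edge k n ` T) f x = (\<Sum>(b, c)\<in>{..<n} \<times> {..<n}. G x b c)" if "x < k"
  proof -
    have *: "{t \<in> T. x \<in> triple_edge k n t}
        = Pair x ` {(b, c) \<in> {..<n} \<times> {..<n}. G x b c \<noteq> 0}"
      using that by (auto simp: T_def support3_def mem_triple_edge)
    show ?thesis unfolding deg *
      by (subst sum.reindex) (auto simp: inj_on_def intro!: sum.mono_neutral_left)
  qed
  show "wdeg (triple_edge k n ` T) f (k + y) = (\<Sum>(a, c)\<in>{..<k} \<times> {..<n}. G a y c)"
    if "y < n"
  proof -
    have *: "{t \<in> T. k + y \<in> triple_edge k n t}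
        = (\<lambda>(a, c). (a, y, c)) ` {(a, c) \<in> {..<k} \<times> {..<n}. G a y c \<noteq> 0}"
      using that by (auto simp: T_def support3_def mem_triple_edge)
    show ?thesis unfolding deg *
      by (subst sum.reindex)
        (auto simp: inj_on_def case_prod_unfold intro!: sum.mono_neutral_left)
  qed
  show "wdeg (triple_edge k n ` T) f (k + n + z) = (\<Sum>(a, b)\<in>{..<k} \<times> {..<n}. G a b z)"
    if "z < n"
  proof -
    have *: "{t \<in> T. k + n + z \<in> triple_edge k n t}
        = (\<lambda>(a, b). (a, b, z)) ` {(a, b) \<in> {..<k} \<times> {..<n}. G a b z \<noteq> 0}"
      using that by (auto simp: T_def support3_def mem_triple_edge)
    show ?thesis unfolding deg *
      by (subst sum.reindex)
        (auto simp: inj_on_def case_prod_unfold intro!: sum.mono_neutral_left)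
  qed
qed

lemma fractionally_balanced_triple_edges:
  fixes G :: "nat \<Rightarrow> nat \<Rightarrow> nat \<Rightarrow> real"
  assumes nonneg: "\<And>a b c. 0 \<le> G a b c"
    and nonzero: "support3 k n G \<noteq> {}"
    and A: "\<And>a. a < k \<Longrightarrow> (\<Sum>(b, c)\<in>{..<n} \<times> {..<n}. G a b c) = \<alpha>"
    and B: "\<And>b. b < n \<Longrightarrow> (\<Sum>(a, c)\<in>{..<k} \<times> {..<n}. G a b c) = \<beta>"
    and C: "\<And>c. c < n \<Longrightarrow> (\<Sum>(a, b)\<in>{..<k} \<times> {..<n}. G a b c) = \<gamma>"
  shows "fractionally_balanced [k, n, n] (tri_sides k n) (triple_edge k n ` support3 k n G)"
proof -
  let ?T = "support3 k n G"
  define f where "f = (\<lambda>(a, b, c). G a b c) \<circ> inv_into ?T (triple_edge k n)"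
  note deg = wdeg_triple_edges[where k = k and n = n and G = G, folded f_def]
  have f: "f (triple_edge k n (a, b, c)) = G a b c" if "(a, b, c) \<in> ?T" for a b c
    using that by (simp add: f_def inv_into_f_f[OF inj_on_triple_edge])
  have "balanced (tri_sides k n) (triple_edge k n ` ?T) f"
    unfolding balanced_def
  proof (intro allI impI)
    fix t assume "t < length (tri_sides k n)"
    hence "t = 0 \<or> t = 1 \<or> t = 2" by (auto simp: tri_sides_def)
    thus "\<exists>c. \<forall>v\<in>tri_sides k n ! t. wdeg (triple_edge k n ` ?T) f v = c"
    proof (elim disjE)
      assume "t = 0"
      thus ?thesis by (intro exI[of _ \<alpha>]) (auto simp: tri_sides_def deg A)
    next
      assume "t = 1"
      moreover have "wdeg (triple_edge k n ` ?T) f v = \<beta>" if "v \<in> {k..<k + n}" for v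
        using that deg(2)[of "v - k"] B[of "v - k"] by auto
      ultimately show ?thesis by (auto simp: tri_sides_def)
    next
      assume "t = 2"
      moreover have "wdeg (triple_edge k n ` ?T) f v = \<gamma>" if "v \<in> {k + n..<k + n + n}" for v
        using that deg(3)[of "v - (k + n)"] C[of "v - (k + n)"] by auto
      ultimately show ?thesis by (auto simp: tri_sides_def)
    qed
  qed
  moreover have "\<forall>e\<in>triple_edge k n ` ?T. 0 \<le> f e"
    using nonneg f by auto
  moreover have "\<exists>e\<in>triple_edge k n ` ?T. f e \<noteq> 0"
  proof -
    obtain a b c where abc: "(a, b, c) \<in> ?T" using nonzero by fastforce
    hence "f (triple_edge k n (a, b, c)) \<noteq> 0" unfolding f[OF abc] by (simp add: support3_def)
    thus ?thesis using abc by blast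
  qed
  moreover have "map card (tri_sides k n) = [k, n, n]" by (simp add: tri_sides_def)
  ultimately show ?thesis
    unfolding fractionally_balanced_def using partite_triple_edges by blast
qed

text \<open>Here \<open>\<phi>\<close> colours the triples with \<open>m\<close> colours so that
  triples of equal colour share a coordinate. Disjoint edges then have distinct colours.\<close>

lemma matching_triple_edges_card_le:
  assumes M: "is_matching (triple_edge k n ` support3 k n G) M"
    and \<phi>: "\<And>a b c. (a, b, c) \<in> support3 k n G \<Longrightarrow> \<phi> (a, b, c) < m"
    and inj: "\<And>a b c a' b' c'. (a, b, c) \<in> support3 k n G \<Longrightarrow> (a', b', c') \<in> support3 k n G \<Longrightarrow>
      a \<noteq> a' \<Longrightarrow> b \<noteq> b' \<Longrightarrow> c \<noteq> c' \<Longrightarrow> \<phi> (a, b, c) \<noteq> \<phi> (a', b', c')"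
  shows "card M \<le> m"
proof -
  obtain S where S: "S \<subseteq> support3 k n G" "M = triple_edge k n ` S"
    using M unfolding is_matching_def by (meson subset_imageE)
  have "inj_on \<phi> S"
  proof (rule inj_onI, rule ccontr)
    fix x y assume xy: "x \<in> S" "y \<in> S" "\<phi> x = \<phi> y" "x \<noteq> y"
    obtain a b c where x: "x = (a, b, c)" by (cases x) auto
    obtain a' b' c' where y: "y = (a', b', c')" by (cases y) auto
    have "triple_edge k n x \<noteq> triple_edge k n y"
      using xy S inj_on_triple_edge[of k n G] by (meson inj_onD subsetD)
    hence "triple_edge k n x \<inter> triple_edge k n y = {}"
      using M xy S unfolding is_matching_def by blast
    hence "a \<noteq> a'" "b \<noteq> b'" "c \<noteq> c'"
      by (auto simp: x y triple_edge_def)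
    thus False using inj[of a b c a' b' c'] xy S x y by auto
  qed
  moreover have "\<phi> ` S \<subseteq> {..<m}" using S \<phi> by auto
  ultimately have "card S \<le> m" by (metis card_inj_on_le card_lessThan finite_lessThan)
  moreover have "finite S" using S finite_support3 finite_subset by blast
  ultimately show ?thesis using S card_image_le[of S "triple_edge k n"] by simp
qed

section \<open>Truncated Fano planes on pairs of vertices\<close>

text \<open>The pairs are \<open>{2 * i, 2 * i + 1}\<close>, identified by \<open>div 2\<close>; for
  each \<open>i\<close> the four triples of even sum are the edges of one truncated Fano
  plane.\<close>

definition fano :: "nat \<Rightarrow> nat \<Rightarrow> nat \<Rightarrow> bool" where
  "fano x y z \<longleftrightarrow> x div 2 = y div 2 \<and> y div 2 = z div 2 \<and> even (x + y + z)"

lemma fano_swap: "fano x y z \<longleftrightarrow> fano y x z"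
  by (auto simp: fano_def)

lemma fano_lt_iff:
  assumes "fano x y z"
  shows "y < 2 * p \<longleftrightarrow> x < 2 * p" "z < 2 * p \<longleftrightarrow> x < 2 * p"
proof -
  have "u < 2 * p \<longleftrightarrow> u div 2 < p" for u :: nat by (auto simp: div_less_iff_less_mult)
  thus "y < 2 * p \<longleftrightarrow> x < 2 * p" "z < 2 * p \<longleftrightarrow> x < 2 * p"
    using assms unfolding fano_def by simp_all
qed

text \<open>Either member of the pair of \<open>x\<close> can serve as \<open>y\<close>, and parity
  then determines \<open>z\<close>.\<close>

lemma card_fano: "card {(y, z). fano x y z} = 2"
proof -
  define q where "q = x div 2"
  define r where "r = x mod 2"
  have r: "r = 0 \<or> r = 1" and x: "x = 2 * q + r" unfolding q_def r_def by auto
  have "fano x y z \<longleftrightarrow> (y = 2 * q \<and> z = 2 * q + r) \<or> (y = 2 * q + 1 \<and> z = 2 * q + (1 - r))" for y z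
  proof -
    define i s j t where "i = y div 2" "s = y mod 2" "j = z div 2" "t = z mod 2"
    note ijst = this
    have "s = 0 \<or> s = 1" "t = 0 \<or> t = 1" "y = 2 * i + s" "z = 2 * j + t"
      unfolding ijst by auto
    with r show ?thesis unfolding fano_def x by (elim disjE; clarsimp; arith)
  qed
  hence "{(y, z). fano x y z} = {(2 * q, 2 * q + r), (2 * q + 1, 2 * q + (1 - r))}"
    by auto
  thus ?thesis by simp
qed

text \<open>The box sizes \<open>m\<close> and \<open>n\<close> may differ because the degrees on
  the second side are sums over \<open>k\<close> by \<open>n\<close> indices.\<close>

lemma sum_fano:
  assumes "x < 2 * p" "2 * p \<le> m" "2 * p \<le> n"
  shows "(\<Sum>(y, z)\<in>{..<m} \<times> {..<n}. if fano x y z then w else (0::real)) = 2 * w"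
proof -
  have "{(y, z). fano x y z} \<subseteq> {..<m} \<times> {..<n}"
    using assms fano_lt_iff[of x _ _ p] by fastforce
  hence "(\<Sum>(y, z)\<in>{..<m} \<times> {..<n}. if fano x y z then w else 0)
      = (\<Sum>(y, z)\<in>{(y, z). fano x y z}. w)"
    by (intro sum.mono_neutral_cong_right) auto
  thus ?thesis using card_fano[of x] by (simp add: case_prod_unfold)
qed

section \<open>The balanced weight\<close>

text \<open>Indices below \<open>2 * p\<close> are paired, the others spare. The divisor is the
  number of spare pairs \<open>(b, c)\<close>, so the numerator is the total that \<open>a\<close>
  sends to them; a paired \<open>a\<close> already receives \<open>k\<close> from its two plane
  edges.\<close>

definition fano_weight :: "nat \<Rightarrow> nat \<Rightarrow> nat \<Rightarrow> nat \<Rightarrow> nat \<Rightarrow> nat \<Rightarrow> real" where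
  "fano_weight k n p a b c =
     (if b < 2 * p then if fano a b c then real k / 2 else 0
      else if c < 2 * p then 0
      else (if a < 2 * p then real n - real k else real n) / (real n - 2 * real p)\<^sup>2)"

lemma sum_fano_weight_first:
  assumes "2 * p \<le> k" "k < n" "a < k"
  shows "(\<Sum>(b, c)\<in>{..<n} \<times> {..<n}. fano_weight k n p a b c) = real n"
proof -
  define w where "w = (if a < 2 * p then real n - real k else real n)"
  define d where "d = real n - 2 * real p"
  have d: "d > 0" "real (n - 2 * p) = d" using assms unfolding d_def by auto
  \<comment> \<open>The guard \<open>a < 2 * p\<close> may replace \<open>b < 2 * p\<close>, since a
    \<open>fano\<close> triple is either entirely paired or entirely spare.\<close>
  have "(\<Sum>(b, c)\<in>{..<n} \<times> {..<n}. fano_weight k n p a b c)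
      = (\<Sum>(b, c)\<in>{..<n} \<times> {..<n}. if a < 2 * p \<and> fano a b c then real k / 2 else 0)
        + (\<Sum>(b, c)\<in>{..<n} \<times> {..<n}. if 2 * p \<le> b \<and> 2 * p \<le> c then w / d\<^sup>2 else 0)"
    unfolding sum.distrib[symmetric]
    by (intro sum.cong refl) (use fano_lt_iff in \<open>auto simp: fano_weight_def w_def d_def\<close>)
  also have "(\<Sum>(b, c)\<in>{..<n} \<times> {..<n}. if 2 * p \<le> b \<and> 2 * p \<le> c then w / d\<^sup>2 else 0)
      = (\<Sum>(b, c)\<in>{2 * p..<n} \<times> {2 * p..<n}. w / d\<^sup>2)"
    by (rule sum.mono_neutral_cong_right) (auto split: if_splits)
  also have "\<dots> = w"
    using d by (simp add: case_prod_unfold power2_eq_square)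
  also have "(\<Sum>(b, c)\<in>{..<n} \<times> {..<n}. if a < 2 * p \<and> fano a b c then real k / 2 else 0)
      = (if a < 2 * p then real k else 0)"
    using assms sum_fano[of a p n n "real k / 2"] by simp
  finally show ?thesis by (simp add: w_def)
qed

lemma sum_fano_weight_second:
  assumes "2 * p \<le> k" "k < n" "b < n"
  shows "(\<Sum>(a, c)\<in>{..<k} \<times> {..<n}. fano_weight k n p a b c) = real k"
proof (cases "b < 2 * p")
  case True
  thus ?thesis
    using assms sum_fano[of b p k n "real k / 2"]
    by (simp add: fano_weight_def fano_swap[of _ b])
next
  case False
  define w where "w a = (if a < 2 * p then real n - real k else real n)" for a
  define d where "d = real n - 2 * real p"
  have d: "d > 0" "real (n - 2 * p) = d" using assms unfolding d_def by auto
  have "(\<Sum>(a, c)\<in>{..<k} \<times> {..<n}. fano_weight k n p a b c)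
      = (\<Sum>(a, c)\<in>{..<k} \<times> {2 * p..<n}. w a / d\<^sup>2)"
    using False
    by (intro sum.mono_neutral_cong_right)
      (auto simp: fano_weight_def w_def d_def split: if_splits)
  also have "\<dots> = (\<Sum>a<k. w a) / d"
    using d by (simp add: sum.cartesian_product[symmetric] power2_eq_square sum_divide_distrib)
  also have "(\<Sum>a<k. w a) = (\<Sum>a<2 * p. w a) + (\<Sum>a\<in>{2 * p..<k}. w a)"
    using assms by (subst sum.union_disjoint[symmetric]) (auto intro!: sum.cong)
  \<comment> \<open>This is \<open>2 * p * (n - k) + (k - 2 * p) * n = k * (n - 2 * p)\<close>, the
    identity that fixes the numerators of the spare weights.\<close>
  also have "\<dots> = real k * d"
    using assms by (simp add: w_def d_def algebra_simps of_nat_diff)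
  finally show ?thesis using d by simp
qed

text \<open>Although the definition tests \<open>b\<close> first, mixed paired and spare indices
  always give zero. The third side thus inherits its degrees from the second.\<close>

lemma fano_weight_swap: "fano_weight k n p a b c = fano_weight k n p a c b"
proof -
  have "fano a b c \<longleftrightarrow> fano a c b" by (auto simp: fano_def)
  moreover have "fano a b c \<Longrightarrow> b < 2 * p \<longleftrightarrow> c < 2 * p"
    using fano_lt_iff by blast
  ultimately show ?thesis by (auto simp: fano_weight_def)
qed

lemma fractionally_balanced_fano_weight:
  assumes "2 * p \<le> k" "0 < k" "k < n"
  shows "fractionally_balanced [k, n, n] (tri_sides k n)
    (triple_edge k n ` support3 k n (fano_weight k n p))"
proof (rule fractionally_balanced_triple_edges)
  show "0 \<le> fano_weight k n p a b c" for a b c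
    using assms by (simp add: fano_weight_def)
  \<comment> \<open>The index \<open>n - 1\<close> is spare because
    \<open>2 * p \<le> k < n\<close>, and spare triples have positive weight.\<close>
  have "(0, n - 1, n - 1) \<in> support3 k n (fano_weight k n p)"
    using assms by (auto simp: support3_def fano_weight_def)
  thus "support3 k n (fano_weight k n p) \<noteq> {}" by blast
  show "(\<Sum>(a, b)\<in>{..<k} \<times> {..<n}. fano_weight k n p a b c) = real k" if "c < n" for c
    using sum_fano_weight_second[OF assms(1,3) that] by (simp add: fano_weight_swap[of _ _ _ _ _ c])
qed (use assms sum_fano_weight_first sum_fano_weight_second in auto)

section \<open>Bounds on matchings\<close>

lemma matching_fano_weight_card_le:
  assumes "2 * p \<le> k" "k < n"
    and M: "is_matching (triple_edge k n ` support3 k n (fano_weight k n p)) M"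
  shows "card M \<le> n - p"
proof (rule matching_triple_edges_card_le[OF M])
  \<comment> \<open>The planes take the colours below \<open>p\<close>; each spare \<open>b\<close>
    takes its own colour, from \<open>p\<close> up to \<open>n - p - 1\<close>.\<close>
  define \<phi> :: "nat \<times> nat \<times> nat \<Rightarrow> nat"
    where "\<phi> = (\<lambda>(a, b, c). if b < 2 * p then b div 2 else b - p)"
  show "\<phi> (a, b, c) < n - p" if "(a, b, c) \<in> support3 k n (fano_weight k n p)" for a b c
    using that assms by (auto simp: \<phi>_def support3_def)
  show "\<phi> (a, b, c) \<noteq> \<phi> (a', b', c')"
    if abc: "(a, b, c) \<in> support3 k n (fano_weight k n p)"
      "(a', b', c') \<in> support3 k n (fano_weight k n p)"
      and ne: "a \<noteq> a'" "b \<noteq> b'" "c \<noteq> c'" for a b c a' b' c'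
  proof
    assume eq: "\<phi> (a, b, c) = \<phi> (a', b', c')"
    \<comment> \<open>Spare colours are at least \<open>p\<close> and determine \<open>b\<close>, so
      equal colours with \<open>b \<noteq> b'\<close> can only come from one plane.\<close>
    have b: "b < 2 * p \<and> b' < 2 * p \<and> b div 2 = b' div 2"
      using eq ne by (auto simp: \<phi>_def split: if_splits)
    hence "fano a b c" "fano a' b' c'"
      using abc by (auto simp: support3_def fano_weight_def split: if_splits)
    \<comment> \<open>Distinct members of one pair differ in parity, and three parity changes cannot cancel.\<close>
    moreover have "odd (x + y)" if "x div 2 = y div 2" "x \<noteq> y" for x y :: nat
      using that by presburger
    ultimately have "odd (a + a')" "odd (b + b')" "odd (c + c')"
      "even (a + b + c)" "even (a' + b' + c')"
      using b ne unfolding fano_def by metis+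
    thus False by auto
  qed
qed

lemma matching_triple_edges_card_le_first:
  assumes "is_matching (triple_edge k n ` support3 k n G) M"
  shows "card M \<le> k"
  by (rule matching_triple_edges_card_le[OF assms, of fst]) (auto simp: support3_def)

section \<open>Passing to \<open>bm\<close>\<close>

lemma bm_le:
  fixes V :: "nat set list"
  assumes "fractionally_balanced b V H" and le: "\<And>M. is_matching H M \<Longrightarrow> card M \<le> m"
  shows "bm b \<le> m"
proof -
  let ?P = "\<lambda>m. \<forall>(V :: nat set list) H. fractionally_balanced b V H \<longrightarrow>
    (\<exists>M. is_matching H M \<and> card M = m)"
  \<comment> \<open>\<open>GREATEST\<close> is meaningful only for a bounded property that holds
    somewhere: the empty matching gives the value 0, and \<open>H\<close> gives the bound
    \<open>m\<close>.\<close>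
  have "?P 0"
    by (auto simp: is_matching_def intro!: exI[of _ "{}"])
  moreover have "y \<le> m" if "?P y" for y
    using that assms by blast
  ultimately have "?P (bm b)"
    unfolding bm_def by (rule GreatestI_nat)
  then obtain M where "is_matching H M" "card M = bm b"
    using assms(1) by blast
  thus ?thesis using le by metis
qed

lemma ex_fractionally_balanced_small_matchings:
  assumes "0 < k" "k < n" "3 * n div 4 \<le> m"
  shows "\<exists>(V :: nat set list) H. fractionally_balanced [k, n, n] V H \<and>
    (\<forall>M. is_matching H M \<longrightarrow> card M \<le> min k m)"
proof -
  define p where "p = k div 2"
  let ?H = "triple_edge k n ` support3 k n (fano_weight k n p)"
  have p: "2 * p \<le> k" by (simp add: p_def)
  have "card M \<le> min k m" if "is_matching ?H M" for M
  proof -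
    have "card M \<le> k" "card M \<le> n - p"
      using that matching_triple_edges_card_le_first matching_fano_weight_card_le p assms by blast+
    \<comment> \<open>For \<open>k \<le> m\<close> the bound \<open>k\<close> suffices; otherwise
      \<open>k\<close> exceeds \<open>3 * n div 4\<close>, which makes \<open>p\<close> large enough
      for \<open>n - p \<le> m\<close>.\<close>
    thus ?thesis using assms unfolding p_def by linarith
  qed
  thus ?thesis using fractionally_balanced_fano_weight[OF p assms(1,2)] by blast
qed

theorem theorem6p1:
  fixes k n :: nat
  assumes "0 < k" and "k < n"
  shows "(even n \<longrightarrow>
            bm [k, n, n] \<le> min k (3 * n div 4) \<and>
            (\<exists>(V :: nat set list) H. fractionally_balanced [k, n, n] V H \<and>
               (\<forall>M. is_matching H M \<longrightarrow> card M \<le> min k (3 * n div 4)))) \<and>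
         (odd n \<longrightarrow>
            bm [k, n, n] \<le> min k ((3 * n + 1) div 4) \<and>
            (\<exists>(V :: nat set list) H. fractionally_balanced [k, n, n] V H \<and>
               (\<forall>M. is_matching H M \<longrightarrow> card M \<le> min k ((3 * n + 1) div 4))))"
proof -
  have "bm [k, n, n] \<le> min k m \<and>
      (\<exists>(V :: nat set list) H. fractionally_balanced [k, n, n] V H \<and>
        (\<forall>M. is_matching H M \<longrightarrow> card M \<le> min k m))" if "3 * n div 4 \<le> m" for m
    using ex_fractionally_balanced_small_matchings[OF assms that] bm_le by blast
  \<comment> \<open>The construction is the same for both parities, so the odd bound follows by
    monotonicity.\<close>
  moreover have "3 * n div 4 \<le> (3 * n + 1) div 4" by (simp add: div_le_mono)
  ultimately show ?thesis by blast
qed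

end
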